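(* Let $p\neq q$ be coprime positive integers satisfying $$5\,q^{3}-\frac{q^{3}}{3600^{3}}\leqslant p\leqslant 5\,q^{3}+\frac{q^{3}}{3600^{3}}\qquad\text{and}\qquad 5\,q^{3}-2q<p<5\,q^{3}+2q.$$ Then the tenth degree cuboid characteristic equation $Q_{pq}(t)=0$ produces no perfect cuboids, i.e. there is no positive integer $t$ such that the triple $(p,q,t)$ produces a perfect cuboid.
   Context: For integers $p,q$ the polynomial $Q_{pq}(t)\in\mathbb Z[t]$ is $$Q_{pq}(t)=t^{10}+(2q^{2}+p^{2})(3q^{2}-2p^{2})\,t^{8}+(q^{8}+10p^{2}q^{6}+4p^{4}q^{4}-14p^{6}q^{2}+p^{8})\,t^{6}-p^{2}q^{2}(q^{8}-14p^{2}q^{6}+4p^{4}q^{4}+10p^{6}q^{2}+p^{8})\,t^{4}-p^{6}q^{6}(q^{2}+2p^{2})(3p^{2}-2q^{2})\,t^{2}-q^{10}p^{10}.$$ A triple of positive integers $(p,q,t)$ with $p\neq q$ coprime is said to produce a perfect cuboid (a rectangular box with integer edges, integer face diagonals and integer space diagonal) exactly when $Q_{pq}(t)=0$ and $t>p^{2}$, $t>pq$, $t>q^{2}$, $(p^{2}+t)(pq+t)>2t^{2}$. *)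

theory Defs
  imports Complex_Main "HOL-Computational_Algebra.Polynomial"
begin

definition cuboid_poly :: "int \<Rightarrow> int \<Rightarrow> int poly" where
  "cuboid_poly p q =
     monom 1 10
   + monom ((2*q^2 + p^2) * (3*q^2 - 2*p^2)) 8
   + monom (q^8 + 10*p^2*q^6 + 4*p^4*q^4 - 14*p^6*q^2 + p^8) 6
   - monom (p^2*q^2 * (q^8 - 14*p^2*q^6 + 4*p^4*q^4 + 10*p^6*q^2 + p^8)) 4
   - monom (p^6*q^6 * (q^2 + 2*p^2) * (3*p^2 - 2*q^2)) 2
   - monom (q^10*p^10) 0"

text \<open>
  Intended for positive \<open>p\<close>, \<open>q\<close>, \<open>t\<close> with \<open>p\<close> and \<open>q\<close> distinct and coprime;
  these side conditions are not part of the predicate.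
\<close>

definition produces_perfect_cuboid :: "int \<Rightarrow> int \<Rightarrow> int \<Rightarrow> bool" where
  "produces_perfect_cuboid p q t \<longleftrightarrow>
     poly (cuboid_poly p q) t = 0 \<and>
     t > p^2 \<and> t > p*q \<and> t > q^2 \<and> (p^2 + t) * (p*q + t) > 2*t^2"

end

theory Submission
  imports Defs
begin

text \<open>
  After division by \<open>t^8\<close> the characteristic polynomial is \<open>(t - p\<^sup>4/t)\<^sup>2\<close> plus a constant minus
  nonnegative multiples (once \<open>p \<ge> 4q\<close>) of negative powers of \<open>t\<close>.  Hence it is increasing on
  \<open>t \<ge> p\<^sup>2\<close> and has at most one root there.  This root has the expansion
  \<open>t = p\<^sup>2 + 2pq - 2q\<^sup>2 + 5q\<^sup>3/p - 20q\<^sup>4/p\<^sup>2 + \<dots>\<close>.  If \<open>p > 5q\<^sup>3 - 2q\<close>, then \<open>5q\<^sup>3/p < 1 + 2q/p\<close>, and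
  for \<open>p\<close> near \<open>5q\<^sup>3\<close> this possible excess over \<open>1\<close> is outweighed by the next term, about \<open>-4q/p\<close>.
  So the root lies strictly between the consecutive integers \<open>p\<^sup>2 + 2pq - 2q\<^sup>2\<close> and
  \<open>p\<^sup>2 + 2pq - 2q\<^sup>2 + 1\<close>.
\<close>

text \<open>Completing the square in the three leading terms absorbs \<open>- 2*p^4*t^8\<close> and
  \<open>p^8*t^6\<close>.\<close>

lemma poly_cuboid_poly:
  "poly (cuboid_poly p q) t =
     t^6 * (t^2 - p^4)^2 + (6*q^4 - p^2*q^2) * t^8
     - (14*p^6*q^2 - 4*p^4*q^4 - 10*p^2*q^6 - q^8) * t^6
     - p^2*q^2 * (q^8 - 14*p^2*q^6 + 4*p^4*q^4 + 10*p^6*q^2 + p^8) * t^4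
     - p^6*q^6 * (q^2 + 2*p^2) * (3*p^2 - 2*q^2) * t^2 - q^10*p^10"
  unfolding cuboid_poly_def poly_add poly_diff poly_monom by algebra

text \<open>Monotonicity of \<open>poly (cuboid_poly p q) t / t^8\<close> for
  \<open>t \<ge> p^2\<close>, cross-multiplied to stay within the integers.\<close>

lemma poly_cuboid_poly_scaled_mono:
  assumes q: "0 < q" and pq: "4*q \<le> p" and a: "p^2 \<le> a" and ab: "a \<le> b"
  shows "poly (cuboid_poly p q) a * b^8 \<le> poly (cuboid_poly p q) b * a^8"
proof -
  \<comment> \<open>In \<open>q\<close> and \<open>x\<close> the polynomials to be estimated have
    only positive coefficients, so their signs can be read off term by term.\<close>
  define x where "x = p - 4*q"
  have x: "0 \<le> x" and p: "p = 4*q + x"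
    using pq by (auto simp: x_def)
  have "0 < p" "0 < a" "0 < b"
    using q pq a ab zero_less_power[of p 2] by linarith+
  define c6 where "c6 = 14*p^6*q^2 - 4*p^4*q^4 - 10*p^2*q^6 - q^8"
  define c4 where "c4 = p^2*q^2 * (q^8 - 14*p^2*q^6 + 4*p^4*q^4 + 10*p^6*q^2 + p^8)"
  define c2 where "c2 = p^6*q^6 * (q^2 + 2*p^2) * (3*p^2 - 2*q^2)"
  have "c6 = 14*x^6*q^2 + 336*x^5*q^3 + 3356*x^4*q^4 + 17856*x^3*q^5 + 53366*x^2*q^6 + 84912*x*q^7
      + 56159*q^8"
    unfolding c6_def p by algebra
  then have c6: "0 \<le> c6"
    using q x by simp
  have "q^8 - 14*p^2*q^6 + 4*p^4*q^4 + 10*p^6*q^2 + p^8 =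
      x^8 + 32*x^7*q + 458*x^6*q^2 + 3824*x^5*q^3 + 20324*x^4*q^4 + 70208*x^3*q^5
      + 153458*x^2*q^6 + 193424*x*q^7 + 107297*q^8"
    unfolding p by algebra
  also have "\<dots> \<ge> 0"
    using q x by simp
  finally have c4: "0 \<le> c4"
    unfolding c4_def by simp
  have "q^2 \<le> p^2"
    using q pq by (intro power_mono) auto
  then have "0 \<le> 3*p^2 - 2*q^2"
    using zero_le_power2[of p] by linarith
  then have c2: "0 \<le> c2"
    unfolding c2_def using \<open>0 < p\<close> q by (intro mult_nonneg_nonneg) auto
  define d where "d = b^2 - a^2"
  have d: "0 \<le> d"
    using ab \<open>0 < a\<close> by (simp add: d_def power_mono)
  \<comment> \<open>The \<open>t^8\<close> terms cancel, and every other term yields a factor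
    \<open>d\<close>. The square contributes \<open>a^2*b^2 - p^8\<close>, which is where
    \<open>p^2 \<le> a\<close> enters.\<close>
  have "poly (cuboid_poly p q) b * a^8 - poly (cuboid_poly p q) a * b^8 =
      a^6*b^6*d * (a^2*b^2 - p^8) + c6 * (a^6*b^6*d) + c4 * (a^4*b^4*d*(a^2 + b^2))
      + c2 * (a^2*b^2*d*(a^4 + a^2*b^2 + b^4))
      + q^10*p^10 * (d*(a^2 + b^2)*(a^4 + b^4))"
    unfolding poly_cuboid_poly c6_def c4_def c2_def d_def by algebra
  moreover have "p^8 \<le> a^2*b^2"
  proof -
    have "p^8 = (p^2)^2 * (p^2)^2"
      by simp
    also have "\<dots> \<le> a^2 * b^2"
      using a ab by (intro mult_mono power_mono) auto
    finally show ?thesis .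
  qed
  ultimately show ?thesis
    using c6 c4 c2 d \<open>0 < p\<close> q
    by (smt (verit, ccfv_threshold) add_nonneg_nonneg mult_nonneg_nonneg zero_le_even_power even_numeral)
qed

text \<open>The value is homogeneous of degree 20 in \<open>p\<close> and \<open>q\<close>, so its
  sign depends only on \<open>p/q\<close>.\<close>

lemma poly_cuboid_poly_neg_at:
  fixes p q :: int
  assumes "0 < q" "4*q \<le> p"
  shows "poly (cuboid_poly p q) (p^2 + 2*p*q - 2*q^2) < 0"
proof -
  define x where "x = p - 4*q"
  have x: "0 \<le> x" and p: "p = 4*q + x"
    using assms by (auto simp: x_def)
  have "- poly (cuboid_poly p q) (p^2 + 2*p*q - 2*q^2) =
      80*x^16*q^4 + 5920*x^15*q^5 + 203808*x^14*q^6 + 4332704*x^13*q^7 + 63656640*x^12*q^8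
      + 685356096*x^11*q^9 + 5593469888*x^10*q^10 + 35300762112*x^9*q^11
      + 174117344944*x^8*q^12 + 673501743584*x^7*q^13 + 2036478004256*x^6*q^14
      + 4763591999712*x^5*q^15 + 8451633741232*x^4*q^16 + 10996900309760*x^3*q^17
      + 9898103373200*x^2*q^18 + 5507297216000*x*q^19 + 1427289720000*q^20"
    unfolding poly_cuboid_poly p by algebra
  also have "\<dots> > 0"
    using \<open>0 < q\<close> x by (intro add_nonneg_pos add_nonneg_nonneg) auto
  finally show ?thesis
    by simp
qed

text \<open>
  The part of degree 20 in \<open>p, q\<close> is \<open>-q\<^sup>3 r\<close> with \<open>r \<ge> 0\<close>; replacing \<open>5q\<^sup>3\<close> by its upper bound
  \<open>p + 2q\<close> turns it into degree 18, where it is dominated.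
\<close>

lemma poly_cuboid_poly_pos_at:
  fixes p q :: int
  assumes "0 < q" "4*q \<le> p" "5*q^3 - 2*q \<le> p"
  shows "0 < poly (cuboid_poly p q) (p^2 + 2*p*q - 2*q^2 + 1)"
proof -
  define x where "x = p - 4*q"
  have x: "0 \<le> x" and p: "p = 4*q + x"
    using assms by (auto simp: x_def)
  \<comment> \<open>\<open>- q^3 * r\<close> is the value at
    \<open>p^2 + 2*p*q - 2*q^2\<close>.\<close>
  define r where "r =
      80*x^16*q + 5920*x^15*q^2 + 203808*x^14*q^3 + 4332704*x^13*q^4 + 63656640*x^12*q^5
      + 685356096*x^11*q^6 + 5593469888*x^10*q^7 + 35300762112*x^9*q^8
      + 174117344944*x^8*q^9 + 673501743584*x^7*q^10 + 2036478004256*x^6*q^11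
      + 4763591999712*x^5*q^12 + 8451633741232*x^4*q^13 + 10996900309760*x^3*q^14
      + 9898103373200*x^2*q^15 + 5507297216000*x*q^16 + 1427289720000*q^17"
  have "0 \<le> r"
    unfolding r_def using \<open>0 < q\<close> x by simp
  \<comment> \<open>The factor 5 matches \<open>5*q^3\<close>. The right-hand side is listed by even
    total degree, from 18 down to 0.\<close>
  have "5 * poly (cuboid_poly p q) (p^2 + 2*p*q - 2*q^2 + 1) - (p + 2*q - 5*q^3) * r =
      160*x^16*q^2 + 11792*x^15*q^3 + 401968*x^14*q^4 + 8409856*x^13*q^5
      + 120820144*x^12*q^6 + 1263272256*x^11*q^7 + 9938690080*x^10*q^8 + 59976588704*x^9*q^9
      + 280342939552*x^8*q^10 + 1017278042000*x^7*q^11 + 2852197073552*x^6*q^12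
      + 6102177272176*x^5*q^13 + 9739584220528*x^4*q^14 + 11165909846800*x^3*q^15
      + 8617478144800*x^2*q^16 + 3958863232000*x*q^17 + 800330680000*q^18 + 20*x^16
      + 2120*x^15*q + 96940*x^14*q^2 + 2611640*x^13*q^3 + 47074960*x^12*q^4
      + 607032800*x^11*q^5 + 5823249920*x^10*q^6 + 42541991280*x^9*q^7
      + 239803754420*x^8*q^8 + 1048449513800*x^7*q^9 + 3548915908780*x^6*q^10
      + 9213870356760*x^5*q^11 + 18005660912520*x^4*q^12 + 25626645657680*x^3*q^13
      + 25072421938920*x^2*q^14 + 15077133603200*x*q^15 + 4201056222000*q^16 + 140*x^14
      + 11240*x^13*q + 404740*x^12*q^2 + 8715800*x^11*q^3 + 125884400*x^10*q^4
      + 1293482000*x^9*q^5 + 9769870120*x^8*q^6 + 55189320720*x^7*q^7 + 234591350220*x^6*q^8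
      + 747489783720*x^5*q^9 + 1759169050900*x^4*q^10 + 2967800358040*x^3*q^11
      + 3395616970200*x^2*q^12 + 2360328132000*x*q^13 + 752589138400*q^14 + 425*x^12
      + 27700*x^11*q + 807795*x^10*q^2 + 13965400*x^9*q^3 + 159645250*x^8*q^4
      + 1272732800*x^7*q^5 + 7262824130*x^6*q^6 + 29917385480*x^5*q^7 + 88365434945*x^4*q^8
      + 182667628620*x^3*q^9 + 251072000515*x^2*q^10 + 206193923200*x*q^11
      + 76582129340*q^12 + 730*x^10 + 38500*x^9*q + 894080*x^8*q^2 + 12047400*x^7*q^3
      + 104367040*x^6*q^4 + 607725200*x^5*q^5 + 2410504380*x^4*q^6 + 6436010200*x^3*q^7
      + 11080484390*x^2*q^8 + 11118814700*x*q^9 + 4943453460*q^10 + 775*x^8 + 32080*x^7*q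
      + 567630*x^6*q^2 + 5606720*x^5*q^3 + 33815340*x^4*q^4 + 127579520*x^3*q^5
      + 294315010*x^2*q^6 + 380056400*x*q^7 + 210644965*q^8 + 520*x^6 + 15920*x^5*q
      + 197320*x^4*q^2 + 1265840*x^3*q^3 + 4432480*x^2*q^4 + 8045600*x*q^5 + 5929440*q^6
      + 215*x^4 + 4340*x^3*q + 31435*x^2*q^2 + 96400*x*q^3 + 106290*q^4 + 50*x^2 + 500*x*q
      + 1100*q^2 + 5"
    unfolding poly_cuboid_poly p r_def by algebra
  also have "\<dots> > 0"
    using \<open>0 < q\<close> x by (intro add_nonneg_pos add_nonneg_nonneg) auto
  finally show ?thesis
    using mult_nonneg_nonneg[OF _ \<open>0 \<le> r\<close>, of "p + 2*q - 5*q^3"] assms(3) by linarith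
qed

theorem theorem9p2:
  fixes p q :: int
  assumes "p > 0" and "q > 0" and "p \<noteq> q" and "coprime p q"
    and "5 * real_of_int q ^ 3 - real_of_int q ^ 3 / 3600 ^ 3 \<le> real_of_int p"
    and "real_of_int p \<le> 5 * real_of_int q ^ 3 + real_of_int q ^ 3 / 3600 ^ 3"
    and "5 * q ^ 3 - 2 * q < p"
    and "p < 5 * q ^ 3 + 2 * q"
  shows "\<not> (\<exists>t::int. t > 0 \<and> produces_perfect_cuboid p q t)"
proof
  assume "\<exists>t::int. t > 0 \<and> produces_perfect_cuboid p q t"
  then obtain t where root: "poly (cuboid_poly p q) t = 0" and t: "p^2 < t"
    by (auto simp: produces_perfect_cuboid_def)
  \<comment> \<open>For \<open>q = 1\<close> the strict bound \<open>3 < p\<close> gives exactly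
    \<open>4 \<le> p\<close>; for \<open>q \<ge> 2\<close>, \<open>4*q \<le> q^3\<close>
    suffices.\<close>
  have pq: "4*q \<le> p"
  proof (cases "q = 1")
    case True
    then show ?thesis
      using assms(7) by simp
  next
    case False
    then have "2*2*q \<le> q*q*q"
      using \<open>q > 0\<close> by (intro mult_mono) auto
    then show ?thesis
      using assms(2,7) unfolding power3_eq_cube by linarith
  qed
  define n where "n = p^2 + 2*p*q - 2*q^2"
  have "q * q \<le> p * q"
    using pq \<open>q > 0\<close> by (intro mult_right_mono) auto
  then have n: "p^2 \<le> n"
    by (simp add: n_def power2_eq_square)
  have neg: "poly (cuboid_poly p q) n < 0"
    using poly_cuboid_poly_neg_at[OF \<open>q > 0\<close> pq] by (simp add: n_def)
  have pos: "0 < poly (cuboid_poly p q) (n + 1)"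
    using poly_cuboid_poly_pos_at[OF \<open>q > 0\<close> pq] assms(7) by (simp add: n_def)
  have "0 < t"
    using t \<open>p > 0\<close> zero_less_power[of p 2] by linarith
  show False
  proof (cases "t \<le> n")
    case True
    then have "0 \<le> poly (cuboid_poly p q) n * t^8"
      using poly_cuboid_poly_scaled_mono[OF \<open>q > 0\<close> pq _ True] t root by simp
    then show False
      using neg \<open>0 < t\<close> by (simp add: zero_le_mult_iff)
  next
    case False
    then have "poly (cuboid_poly p q) (n + 1) * t^8 \<le> 0"
      using poly_cuboid_poly_scaled_mono[OF \<open>q > 0\<close> pq, of "n + 1" t] n root by simp
    then show False
      using pos \<open>0 < t\<close> by (simp add: mult_le_0_iff)
  qed
qed

end
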